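(* Let $\mathbb{P}_{\mathsf{aux}}(\cdot,\cdot)$ be the transition kernel of the Markov chain on $\Theta$ defined by the auxiliary-based MCMC algorithm described in the context, with target distribution $\Pi$, auxiliary laws $\mathbb{P}_\theta$ and $\mathbb{P}_{\theta,\theta'}(\cdot\mid\omega_1)$, and proposal densities $q_{\omega_1}$. Then $\mathbb{P}_{\mathsf{aux}}(\cdot,\cdot)$ is reversible with respect to $\Pi$.
   Context: Setting. $\Pi$ is a target distribution on a space $\Theta$ with base measure $\lambda$; $\Pi(\theta)$ denotes its density with respect to $\lambda$. $(\Omega_1,\mathcal{F}_1)$ and $(\Omega_2,\mathcal{F}_2)$ are measurable spaces with base measures $\lambda_1$ and $\lambda_2$. $\{\mathbb{P}_\theta\}_{\theta\in\Theta}$ is a family of probability measures on $\Omega_1$, and $\{\mathbb{P}_{\theta,\theta'}(\cdot\mid\omega_1)\}$ is a family of probability measures on $\Omega_2$ parameterized by $(\theta,\theta')\in\Theta\times\Theta$ and $\omega_1\in\Omega_1$ (the conditional distribution of $\omega_2$ given $\omega_1$). The densities with respect to $\lambda_1$ and $\lambda_2$ are written $\mathbb{P}_\theta(\omega_1)$ and $\mathbb{P}_{\theta,\theta'}(\omega_2\mid\omega_1)$, and the joint distribution on $\Omega_1\times\Omega_2$ is $\mathbb{P}_{\theta,\theta'}(\omega_1,\omega_2):=\mathbb{P}_\theta(\omega_1)\,\mathbb{P}_{\theta,\theta'}(\omega_2\mid\omega_1)$. For each $\omega_1\in\Omega_1$, $Q_{\omega_1}$ is a Markov transition kernel on $\Theta$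 such that $Q_{\omega_1}(\theta,\cdot)$ has density $q_{\omega_1}(\theta,\cdot)$ with respect to $\lambda$. Algorithm (auxiliary-based MCMC). From the current state $\theta$, one step of the chain is: (1) sample $\omega_1\sim\mathbb{P}_\theta(\cdot)$; (2) propose $\theta'\sim q_{\omega_1}(\theta,\cdot)$; (3) sample $\omega_2\sim\mathbb{P}_{\theta,\theta'}(\cdot\mid\omega_1)$; (4) compute the acceptance ratio $$r=\frac{\Pi(\theta')\,\mathbb{P}_{\theta',\theta}(\omega_1,\omega_2)}{\Pi(\theta)\,\mathbb{P}_{\theta,\theta'}(\omega_1,\omega_2)}\cdot\frac{q_{\omega_1}(\theta',\theta)}{q_{\omega_1}(\theta,\theta')};$$ (5) with probability $\min\{1,r\}$ the next state is $\theta'$; otherwise the next state is $\theta$. A kernel $P$ is reversible with respect to $\Pi$ if $\Pi(d\theta)P(\theta,d\theta')=\Pi(d\theta')P(\theta',d\theta)$ as measures on $\Theta\times\Theta$. *)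

theory Defs
  imports "HOL-Probability.Probability"
begin

text \<open>
  Conventions used throughout: \<open>\<Theta>\<close>, \<open>\<Omega>\<^sub>1\<close>, \<open>\<Omega>\<^sub>2\<close> are the spaces of the base measures
  \<open>lam\<close>, \<open>lam1\<close>, \<open>lam2\<close>. Upper-case \<open>P1 \<theta>\<close>, \<open>P2 \<theta> \<theta>' \<omega>1\<close>, \<open>Q \<omega>1 \<theta>\<close> are the probability
  measures, lower-case \<open>p1\<close>, \<open>p2\<close>, \<open>q\<close> their densities; \<open>target\<close> is the distribution \<open>\<Pi>\<close> and
  \<open>p\<close> its density.
\<close>

definition joint_density ::
  "('a \<Rightarrow> 'b \<Rightarrow> real) \<Rightarrow> ('a \<Rightarrow> 'a \<Rightarrow> 'b \<Rightarrow> 'c \<Rightarrow> real) \<Rightarrow> 'a \<Rightarrow> 'a \<Rightarrow> 'b \<Rightarrow> 'c \<Rightarrow> real"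
where
  "joint_density p1 p2 \<theta> \<theta>' \<omega>1 \<omega>2 = p1 \<theta> \<omega>1 * p2 \<theta> \<theta>' \<omega>1 \<omega>2"

text \<open>
  Where a denominator vanishes the ratio is \<open>0\<close>, since \<open>x / 0 = 0\<close>. Under the target followed
  by the first three sampling steps this happens with probability zero.
\<close>

definition acceptance_ratio ::
  "('a \<Rightarrow> real) \<Rightarrow> ('a \<Rightarrow> 'b \<Rightarrow> real) \<Rightarrow> ('a \<Rightarrow> 'a \<Rightarrow> 'b \<Rightarrow> 'c \<Rightarrow> real) \<Rightarrow>
   ('b \<Rightarrow> 'a \<Rightarrow> 'a \<Rightarrow> real) \<Rightarrow> 'a \<Rightarrow> 'a \<Rightarrow> 'b \<Rightarrow> 'c \<Rightarrow> real"
where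
  "acceptance_ratio p p1 p2 q \<theta> \<theta>' \<omega>1 \<omega>2 =
     (p \<theta>' * joint_density p1 p2 \<theta>' \<theta> \<omega>1 \<omega>2) / (p \<theta> * joint_density p1 p2 \<theta> \<theta>' \<omega>1 \<omega>2)
     * (q \<omega>1 \<theta>' \<theta> / q \<omega>1 \<theta> \<theta>')"

definition aux_kernel ::
  "'a measure \<Rightarrow> ('a \<Rightarrow> real) \<Rightarrow>
   ('a \<Rightarrow> 'b measure) \<Rightarrow> ('a \<Rightarrow> 'b \<Rightarrow> real) \<Rightarrow>
   ('a \<Rightarrow> 'a \<Rightarrow> 'b \<Rightarrow> 'c measure) \<Rightarrow> ('a \<Rightarrow> 'a \<Rightarrow> 'b \<Rightarrow> 'c \<Rightarrow> real) \<Rightarrow>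
   ('b \<Rightarrow> 'a \<Rightarrow> 'a measure) \<Rightarrow> ('b \<Rightarrow> 'a \<Rightarrow> 'a \<Rightarrow> real) \<Rightarrow> 'a \<Rightarrow> 'a measure"
where
  "aux_kernel lam p P1 p1 P2 p2 Q q \<theta> =
     do {
       \<omega>1 \<leftarrow> P1 \<theta>;
       \<theta>' \<leftarrow> Q \<omega>1 \<theta>;
       \<omega>2 \<leftarrow> P2 \<theta> \<theta>' \<omega>1;
       accept \<leftarrow> measure_pmf (bernoulli_pmf (min 1 (acceptance_ratio p p1 p2 q \<theta> \<theta>' \<omega>1 \<omega>2)));
       return lam (if accept then \<theta>' else \<theta>)
     }"

definition markov_kernel :: "'a measure \<Rightarrow> ('a \<Rightarrow> 'a measure) \<Rightarrow> bool" where
  "markov_kernel M K \<longleftrightarrow> K \<in> M \<rightarrow>\<^sub>M prob_algebra M"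

text \<open>
  The two sides of the equation are the measures \<open>target(d\<theta>) K(\<theta>, d\<theta>')\<close> and \<open>target(d\<theta>') K(\<theta>', d\<theta>)\<close>
  of the pair \<open>(\<theta>, \<theta>')\<close>. The kernel requirement makes the monadic composition meaningful.
\<close>

definition reversible :: "'a measure \<Rightarrow> ('a \<Rightarrow> 'a measure) \<Rightarrow> bool" where
  "reversible target K \<longleftrightarrow>
     markov_kernel target K \<and>
     do { \<theta> \<leftarrow> target; \<theta>' \<leftarrow> K \<theta>; return (target \<Otimes>\<^sub>M target) (\<theta>, \<theta>') } =
     do { \<theta>' \<leftarrow> target; \<theta> \<leftarrow> K \<theta>'; return (target \<Otimes>\<^sub>M target) (\<theta>, \<theta>') }"

end

theory Submission
  imports Defs
begin

text \<open>
  A step either rejects, which contributes a measure on the diagonal and is trivially symmetric, or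
  it accepts. The accepted moves from \<open>\<theta>\<close> have a density with respect to the target that is symmetric
  where \<open>p > 0\<close>, because \<open>D * min 1 (D' / D) = min D D'\<close>. The base measures are not assumed
  \<open>\<sigma>\<close>-finite, so Fubini is only ever applied to the probability measures \<open>target\<close> and \<open>P1 \<theta>\<close>; the
  integrals over \<open>lam1\<close> and \<open>lam2\<close> are never exchanged.
\<close>

section \<open>Measurability of Bernoulli laws and of integrals against kernels\<close>

text \<open>\<open>bernoulli_pmf\<close> clamps its parameter to [0, 1], so both point masses are
  measurable functions of it, and the measure of a set of Booleans is a finite sum of them. This
  covers the coin toss in \<open>aux_kernel\<close>.\<close>

lemma measurable_bernoulli_pmf [measurable (raw)]:
  assumes [measurable]: "f \<in> borel_measurable M"
  shows "(\<lambda>x. measure_pmf (bernoulli_pmf (f x))) \<in> M \<rightarrow>\<^sub>M prob_algebra (count_space UNIV)"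
proof (rule measurable_prob_algebraI)
  show "(\<lambda>x. measure_pmf (bernoulli_pmf (f x))) \<in> M \<rightarrow>\<^sub>M subprob_algebra (count_space UNIV)"
  proof (rule measurable_subprob_algebra)
    fix A :: "bool set"
    have "pmf (bernoulli_pmf r) b = (if b then min 1 (max 0 r) else 1 - min 1 (max 0 r))" for r b
      by (simp add: bernoulli_pmf.rep_eq)
    then show "(\<lambda>x. emeasure (measure_pmf (bernoulli_pmf (f x))) A) \<in> borel_measurable M"
      by (simp add: emeasure_measure_pmf_finite)
  qed (auto simp: measure_pmf.subprob_space_axioms)
qed (rule prob_space_measure_pmf)

text \<open>The integrating measure varies with the parameter; the kernel property takes the place
  that sigma-finiteness has for a fixed measure.\<close>

lemma measurable_nn_integral_kernel:
  assumes "L \<in> M \<rightarrow>\<^sub>M prob_algebra N" "(\<lambda>(x, y). f x y) \<in> borel_measurable (M \<Otimes>\<^sub>M N)"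
  shows "(\<lambda>x. \<integral>\<^sup>+y. f x y \<partial>L x) \<in> borel_measurable M"
  using assms by (intro nn_integral_measurable_subprob_algebra2 measurable_prob_algebraD)

section \<open>The setting and the measurability of its data\<close>

text \<open>Collects the hypotheses of the theorem so that measurability rules derived from them can
  be declared once. Kernels and densities are measurable jointly in their parameters, as nested
  binds and iterated integrals require.\<close>

locale auxiliary_mcmc =
  fixes lam :: "'a measure" and lam1 :: "'b measure" and lam2 :: "'c measure"
    and target :: "'a measure" and p :: "'a \<Rightarrow> real"
    and P1 :: "'a \<Rightarrow> 'b measure" and p1 :: "'a \<Rightarrow> 'b \<Rightarrow> real"
    and P2 :: "'a \<Rightarrow> 'a \<Rightarrow> 'b \<Rightarrow> 'c measure" and p2 :: "'a \<Rightarrow> 'a \<Rightarrow> 'b \<Rightarrow> 'c \<Rightarrow> real"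
    and Q :: "'b \<Rightarrow> 'a \<Rightarrow> 'a measure" and q :: "'b \<Rightarrow> 'a \<Rightarrow> 'a \<Rightarrow> real"
  assumes prob_target: "prob_space target"
    and measurable_p [measurable]: "p \<in> borel_measurable lam"
    and p_nonneg: "\<And>\<theta>. \<theta> \<in> space lam \<Longrightarrow> 0 \<le> p \<theta>"
    and target_eq: "target = density lam (\<lambda>\<theta>. ennreal (p \<theta>))"
    and measurable_P1 [measurable]: "P1 \<in> lam \<rightarrow>\<^sub>M prob_algebra lam1"
    and measurable_p1: "(\<lambda>(\<theta>, \<omega>1). p1 \<theta> \<omega>1) \<in> borel_measurable (lam \<Otimes>\<^sub>M lam1)"
    and p1_nonneg: "\<And>\<theta> \<omega>1. \<theta> \<in> space lam \<Longrightarrow> \<omega>1 \<in> space lam1 \<Longrightarrow> 0 \<le> p1 \<theta> \<omega>1"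
    and P1_eq: "\<And>\<theta>. \<theta> \<in> space lam \<Longrightarrow> P1 \<theta> = density lam1 (\<lambda>\<omega>1. ennreal (p1 \<theta> \<omega>1))"
    and measurable_P2: "(\<lambda>(\<theta>, \<theta>', \<omega>1). P2 \<theta> \<theta>' \<omega>1) \<in> lam \<Otimes>\<^sub>M lam \<Otimes>\<^sub>M lam1 \<rightarrow>\<^sub>M prob_algebra lam2"
    and measurable_p2: "(\<lambda>(\<theta>, \<theta>', \<omega>1, \<omega>2). p2 \<theta> \<theta>' \<omega>1 \<omega>2)
           \<in> borel_measurable (lam \<Otimes>\<^sub>M lam \<Otimes>\<^sub>M lam1 \<Otimes>\<^sub>M lam2)"
    and p2_nonneg: "\<And>\<theta> \<theta>' \<omega>1 \<omega>2. \<theta> \<in> space lam \<Longrightarrow> \<theta>' \<in> space lam \<Longrightarrow> \<omega>1 \<in> space lam1 \<Longrightarrow>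
           \<omega>2 \<in> space lam2 \<Longrightarrow> 0 \<le> p2 \<theta> \<theta>' \<omega>1 \<omega>2"
    and P2_eq: "\<And>\<theta> \<theta>' \<omega>1. \<theta> \<in> space lam \<Longrightarrow> \<theta>' \<in> space lam \<Longrightarrow> \<omega>1 \<in> space lam1 \<Longrightarrow>
           P2 \<theta> \<theta>' \<omega>1 = density lam2 (\<lambda>\<omega>2. ennreal (p2 \<theta> \<theta>' \<omega>1 \<omega>2))"
    and measurable_Q: "(\<lambda>(\<omega>1, \<theta>). Q \<omega>1 \<theta>) \<in> lam1 \<Otimes>\<^sub>M lam \<rightarrow>\<^sub>M prob_algebra lam"
    and measurable_q: "(\<lambda>(\<omega>1, \<theta>, \<theta>'). q \<omega>1 \<theta> \<theta>') \<in> borel_measurable (lam1 \<Otimes>\<^sub>M lam \<Otimes>\<^sub>M lam)"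
    and q_nonneg: "\<And>\<omega>1 \<theta> \<theta>'. \<omega>1 \<in> space lam1 \<Longrightarrow> \<theta> \<in> space lam \<Longrightarrow> \<theta>' \<in> space lam \<Longrightarrow> 0 \<le> q \<omega>1 \<theta> \<theta>'"
    and Q_eq: "\<And>\<omega>1 \<theta>. \<omega>1 \<in> space lam1 \<Longrightarrow> \<theta> \<in> space lam \<Longrightarrow>
           Q \<omega>1 \<theta> = density lam (\<lambda>\<theta>'. ennreal (q \<omega>1 \<theta> \<theta>'))"
begin

sublocale prob_space target
  by (rule prob_target)

lemma sets_target [simp, measurable_cong]: "sets target = sets lam"
  by (simp add: target_eq)

lemma space_target [simp]: "space target = space lam"
  by (simp add: target_eq)

text \<open>This rule and the four after it turn joint measurability on tuples into rules for
  arbitrary measurable arguments, the form that the \<open>measurable\<close> method can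
  apply.\<close>

lemma measurable_p1' [measurable (raw)]:
  "f \<in> M \<rightarrow>\<^sub>M lam \<Longrightarrow> g \<in> M \<rightarrow>\<^sub>M lam1 \<Longrightarrow> (\<lambda>x. p1 (f x) (g x)) \<in> borel_measurable M"
  using measurable_compose[OF measurable_Pair measurable_p1] by simp

lemma measurable_p2' [measurable (raw)]:
  "f \<in> M \<rightarrow>\<^sub>M lam \<Longrightarrow> f' \<in> M \<rightarrow>\<^sub>M lam \<Longrightarrow> g \<in> M \<rightarrow>\<^sub>M lam1 \<Longrightarrow> h \<in> M \<rightarrow>\<^sub>M lam2 \<Longrightarrow>
     (\<lambda>x. p2 (f x) (f' x) (g x) (h x)) \<in> borel_measurable M"
  using measurable_compose[OF measurable_Pair[OF _ measurable_Pair[OF _ measurable_Pair]] measurable_p2]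
  by simp

lemma measurable_q' [measurable (raw)]:
  "g \<in> M \<rightarrow>\<^sub>M lam1 \<Longrightarrow> f \<in> M \<rightarrow>\<^sub>M lam \<Longrightarrow> f' \<in> M \<rightarrow>\<^sub>M lam \<Longrightarrow>
     (\<lambda>x. q (g x) (f x) (f' x)) \<in> borel_measurable M"
  using measurable_compose[OF measurable_Pair[OF _ measurable_Pair] measurable_q] by simp

lemma measurable_P2' [measurable (raw)]:
  "f \<in> M \<rightarrow>\<^sub>M lam \<Longrightarrow> f' \<in> M \<rightarrow>\<^sub>M lam \<Longrightarrow> g \<in> M \<rightarrow>\<^sub>M lam1 \<Longrightarrow>
     (\<lambda>x. P2 (f x) (f' x) (g x)) \<in> M \<rightarrow>\<^sub>M prob_algebra lam2"
  using measurable_compose[OF measurable_Pair[OF _ measurable_Pair] measurable_P2] by simp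

lemma measurable_Q' [measurable (raw)]:
  "g \<in> M \<rightarrow>\<^sub>M lam1 \<Longrightarrow> f \<in> M \<rightarrow>\<^sub>M lam \<Longrightarrow> (\<lambda>x. Q (g x) (f x)) \<in> M \<rightarrow>\<^sub>M prob_algebra lam"
  using measurable_compose[OF measurable_Pair measurable_Q] by simp

section \<open>Acceptance probability, kernel, and accepted and rejected mass\<close>

abbreviation accept_prob where
  "accept_prob \<theta> \<theta>' \<omega>1 \<omega>2 \<equiv> min 1 (acceptance_ratio p p1 p2 q \<theta> \<theta>' \<omega>1 \<omega>2)"

lemma measurable_acceptance_ratio [measurable (raw)]:
  assumes [measurable]: "f \<in> M \<rightarrow>\<^sub>M lam" "f' \<in> M \<rightarrow>\<^sub>M lam" "g \<in> M \<rightarrow>\<^sub>M lam1" "h \<in> M \<rightarrow>\<^sub>M lam2"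
  shows "(\<lambda>x. acceptance_ratio p p1 p2 q (f x) (f' x) (g x) (h x)) \<in> borel_measurable M"
  unfolding acceptance_ratio_def joint_density_def by measurable

text \<open>Every factor of the ratio is nonnegative. Together with the bound 1 from
  \<open>min\<close>, this keeps the parameter of the coin toss in [0, 1], where
  \<open>bernoulli_pmf\<close> does not clamp.\<close>

lemma accept_prob_nonneg:
  assumes "\<theta> \<in> space lam" "\<theta>' \<in> space lam" "\<omega>1 \<in> space lam1" "\<omega>2 \<in> space lam2"
  shows "0 \<le> accept_prob \<theta> \<theta>' \<omega>1 \<omega>2"
  using assms by (simp add: acceptance_ratio_def joint_density_def p_nonneg p1_nonneg p2_nonneg q_nonneg)

abbreviation kernel :: "'a \<Rightarrow> 'a measure" where
  "kernel \<equiv> aux_kernel lam p P1 p1 P2 p2 Q q"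

lemma measurable_kernel: "kernel \<in> lam \<rightarrow>\<^sub>M prob_algebra lam"
  unfolding aux_kernel_def by measurable

text \<open>Conditional probability of acceptance given the current state, \<open>\<omega>1\<close>
  and the proposal.\<close>

definition accept_mass :: "'a \<Rightarrow> 'b \<Rightarrow> 'a \<Rightarrow> ennreal" where
  "accept_mass \<theta> \<omega>1 \<theta>' = (\<integral>\<^sup>+\<omega>2. accept_prob \<theta> \<theta>' \<omega>1 \<omega>2 \<partial>P2 \<theta> \<theta>' \<omega>1)"

definition reject_mass :: "'a \<Rightarrow> 'b \<Rightarrow> 'a \<Rightarrow> ennreal" where
  "reject_mass \<theta> \<omega>1 \<theta>' = (\<integral>\<^sup>+\<omega>2. 1 - accept_prob \<theta> \<theta>' \<omega>1 \<omega>2 \<partial>P2 \<theta> \<theta>' \<omega>1)"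

text \<open>The weight that rejection puts on the point \<open>\<theta>\<close>. An accepted
  proposal that happens to equal \<open>\<theta>\<close> counts as a move instead.\<close>

definition total_reject_mass :: "'a \<Rightarrow> ennreal" where
  "total_reject_mass \<theta> = (\<integral>\<^sup>+\<omega>1. \<integral>\<^sup>+\<theta>'. reject_mass \<theta> \<omega>1 \<theta>' \<partial>Q \<omega>1 \<theta> \<partial>P1 \<theta>)"

text \<open>
  Dividing by \<open>p\<close> turns a density with respect to \<open>lam\<close> into one with respect to \<open>target\<close>. Nothing is
  lost where \<open>p \<theta>' = 0\<close>, as such a proposal is never accepted.
\<close>

definition move_density :: "'a \<Rightarrow> 'a \<Rightarrow> ennreal" where
  "move_density \<theta> \<theta>' = (\<integral>\<^sup>+\<omega>1. ennreal (q \<omega>1 \<theta> \<theta>' / p \<theta>') * accept_mass \<theta> \<omega>1 \<theta>' \<partial>P1 \<theta>)"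

lemma measurable_accept_mass [measurable (raw)]:
  assumes [measurable]: "f \<in> M \<rightarrow>\<^sub>M lam" "g \<in> M \<rightarrow>\<^sub>M lam1" "f' \<in> M \<rightarrow>\<^sub>M lam"
  shows "(\<lambda>x. accept_mass (f x) (g x) (f' x)) \<in> borel_measurable M"
  unfolding accept_mass_def by (rule measurable_nn_integral_kernel[where N=lam2]) measurable

lemma measurable_move_density [measurable (raw)]:
  assumes [measurable]: "f \<in> M \<rightarrow>\<^sub>M lam" "f' \<in> M \<rightarrow>\<^sub>M lam"
  shows "(\<lambda>x. move_density (f x) (f' x)) \<in> borel_measurable M"
  unfolding move_density_def by (rule measurable_nn_integral_kernel[where N=lam1]) measurable

lemma measurable_reject_mass [measurable (raw)]:
  assumes [measurable]: "f \<in> M \<rightarrow>\<^sub>M lam" "g \<in> M \<rightarrow>\<^sub>M lam1" "f' \<in> M \<rightarrow>\<^sub>M lam"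
  shows "(\<lambda>x. reject_mass (f x) (g x) (f' x)) \<in> borel_measurable M"
  unfolding reject_mass_def by (rule measurable_nn_integral_kernel[where N=lam2]) measurable

lemma measurable_total_reject_mass [measurable]: "total_reject_mass \<in> borel_measurable lam"
proof -
  \<comment> \<open>The outer integral is over \<open>P1 \<theta>\<close>, so the inner one must be
    measurable jointly in \<open>\<theta>\<close> and \<open>\<omega>1\<close> before the kernel
    rule applies again.\<close>
  have [measurable]: "(\<lambda>x. \<integral>\<^sup>+\<theta>'. reject_mass (fst x) (snd x) \<theta>' \<partial>Q (snd x) (fst x))
      \<in> borel_measurable (lam \<Otimes>\<^sub>M lam1)"
    by (rule measurable_nn_integral_kernel[where N=lam]) measurable
  show ?thesis
    unfolding total_reject_mass_def
    by (rule measurable_nn_integral_kernel[where N=lam1]) (simp_all add: case_prod_beta')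
qed

section \<open>Splitting a step into accepted moves and rejection\<close>

lemma sets_kernels:
  "\<theta> \<in> space lam \<Longrightarrow> sets (P1 \<theta>) = sets lam1"
  "\<theta> \<in> space lam \<Longrightarrow> \<theta>' \<in> space lam \<Longrightarrow> \<omega>1 \<in> space lam1 \<Longrightarrow> sets (P2 \<theta> \<theta>' \<omega>1) = sets lam2"
  "\<omega>1 \<in> space lam1 \<Longrightarrow> \<theta> \<in> space lam \<Longrightarrow> sets (Q \<omega>1 \<theta>) = sets lam"
  by (simp_all add: P1_eq P2_eq Q_eq)

lemma space_kernels:
  "\<theta> \<in> space lam \<Longrightarrow> space (P1 \<theta>) = space lam1"
  "\<theta> \<in> space lam \<Longrightarrow> \<theta>' \<in> space lam \<Longrightarrow> \<omega>1 \<in> space lam1 \<Longrightarrow> space (P2 \<theta> \<theta>' \<omega>1) = space lam2"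
  "\<omega>1 \<in> space lam1 \<Longrightarrow> \<theta> \<in> space lam \<Longrightarrow> space (Q \<omega>1 \<theta>) = space lam"
  by (simp_all add: P1_eq P2_eq Q_eq)

text \<open>The binds are peeled off from the outside in, each becoming an integral. The coin toss
  then splits \<open>f\<close> into its values at the proposal and at \<open>\<theta>\<close>; the
  latter is constant in all sampled variables, so rejection contributes only a multiple of
  \<open>f \<theta>\<close>.\<close>

lemma nn_integral_kernel:
  assumes \<theta>: "\<theta> \<in> space lam" and f [measurable]: "f \<in> borel_measurable lam"
  shows "(\<integral>\<^sup>+\<theta>'. f \<theta>' \<partial>kernel \<theta>) =
    (\<integral>\<^sup>+\<omega>1. \<integral>\<^sup>+\<theta>'. accept_mass \<theta> \<omega>1 \<theta>' * f \<theta>' \<partial>Q \<omega>1 \<theta> \<partial>P1 \<theta>) + total_reject_mass \<theta> * f \<theta>"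
proof -
  note [measurable] = \<theta>
  \<comment> \<open>The sigma-algebra of each sampling law is that of its base measure only at
    points of the underlying spaces, so these facts are declared locally, once the points are
    fixed.\<close>
  note [measurable_cong] = sets_kernels(1)[OF \<theta>]
  \<comment> \<open>The coin toss by itself, for fixed samples.\<close>
  have step: "(\<integral>\<^sup>+x. f x \<partial>(measure_pmf (bernoulli_pmf (accept_prob \<theta> \<theta>' \<omega>1 \<omega>2)) \<bind>
        (\<lambda>b. return lam (if b then \<theta>' else \<theta>)))) =
      accept_prob \<theta> \<theta>' \<omega>1 \<omega>2 * f \<theta>' + (1 - accept_prob \<theta> \<theta>' \<omega>1 \<omega>2) * f \<theta>"
    if "\<omega>1 \<in> space lam1" "\<theta>' \<in> space lam" "\<omega>2 \<in> space lam2" for \<omega>1 \<theta>' \<omega>2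
  proof -
    have "(\<integral>\<^sup>+x. f x \<partial>(measure_pmf (bernoulli_pmf (accept_prob \<theta> \<theta>' \<omega>1 \<omega>2)) \<bind>
        (\<lambda>b. return lam (if b then \<theta>' else \<theta>)))) =
      (\<integral>\<^sup>+b. \<integral>\<^sup>+x. f x \<partial>return lam (if b then \<theta>' else \<theta>)
         \<partial>measure_pmf (bernoulli_pmf (accept_prob \<theta> \<theta>' \<omega>1 \<omega>2)))"
      using that \<theta> by (intro nn_integral_bind[where B=lam] f)
        (auto intro!: return_measurable[THEN measurable_space])
    also have "\<dots> = accept_prob \<theta> \<theta>' \<omega>1 \<omega>2 * f \<theta>' + (1 - accept_prob \<theta> \<theta>' \<omega>1 \<omega>2) * f \<theta>"
      using that \<theta> accept_prob_nonneg[of \<theta> \<theta>' \<omega>1 \<omega>2]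
      by (simp add: nn_integral_return mult.commute)
    finally show ?thesis .
  qed
  have "(\<integral>\<^sup>+\<theta>'. f \<theta>' \<partial>kernel \<theta>) =
    (\<integral>\<^sup>+\<omega>1. \<integral>\<^sup>+x. f x \<partial>(Q \<omega>1 \<theta> \<bind> (\<lambda>\<theta>'. P2 \<theta> \<theta>' \<omega>1 \<bind> (\<lambda>\<omega>2.
      measure_pmf (bernoulli_pmf (accept_prob \<theta> \<theta>' \<omega>1 \<omega>2)) \<bind> (\<lambda>b. return lam (if b then \<theta>' else \<theta>))))) \<partial>P1 \<theta>)"
    unfolding aux_kernel_def
    by (intro nn_integral_bind[where B=lam] f measurable_prob_algebraD) measurable
  also have "\<dots> = (\<integral>\<^sup>+\<omega>1. \<integral>\<^sup>+\<theta>'. accept_mass \<theta> \<omega>1 \<theta>' * f \<theta>' +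
      reject_mass \<theta> \<omega>1 \<theta>' * f \<theta> \<partial>Q \<omega>1 \<theta> \<partial>P1 \<theta>)"
  proof (intro nn_integral_cong)
    fix \<omega>1 assume "\<omega>1 \<in> space (P1 \<theta>)"
    then have \<omega>1 [measurable]: "\<omega>1 \<in> space lam1"
      using \<theta> by (simp add: space_kernels)
    note [measurable_cong] = sets_kernels(3)[OF \<omega>1 \<theta>]
    have "(\<integral>\<^sup>+x. f x \<partial>(Q \<omega>1 \<theta> \<bind> (\<lambda>\<theta>'. P2 \<theta> \<theta>' \<omega>1 \<bind> (\<lambda>\<omega>2.
        measure_pmf (bernoulli_pmf (accept_prob \<theta> \<theta>' \<omega>1 \<omega>2)) \<bind> (\<lambda>b. return lam (if b then \<theta>' else \<theta>)))))) =
      (\<integral>\<^sup>+\<theta>'. \<integral>\<^sup>+x. f x \<partial>(P2 \<theta> \<theta>' \<omega>1 \<bind> (\<lambda>\<omega>2.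
        measure_pmf (bernoulli_pmf (accept_prob \<theta> \<theta>' \<omega>1 \<omega>2)) \<bind> (\<lambda>b. return lam (if b then \<theta>' else \<theta>)))) \<partial>Q \<omega>1 \<theta>)"
      by (intro nn_integral_bind[where B=lam] f measurable_prob_algebraD) measurable
    also have "\<dots> = (\<integral>\<^sup>+\<theta>'. accept_mass \<theta> \<omega>1 \<theta>' * f \<theta>' +
      reject_mass \<theta> \<omega>1 \<theta>' * f \<theta> \<partial>Q \<omega>1 \<theta>)"
    proof (intro nn_integral_cong)
      fix \<theta>' assume "\<theta>' \<in> space (Q \<omega>1 \<theta>)"
      then have \<theta>' [measurable]: "\<theta>' \<in> space lam"
        using \<theta> \<omega>1 by (simp add: space_kernels)
      note [measurable_cong] = sets_kernels(2)[OF \<theta> \<theta>' \<omega>1]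
      have "(\<integral>\<^sup>+x. f x \<partial>(P2 \<theta> \<theta>' \<omega>1 \<bind> (\<lambda>\<omega>2.
          measure_pmf (bernoulli_pmf (accept_prob \<theta> \<theta>' \<omega>1 \<omega>2)) \<bind> (\<lambda>b. return lam (if b then \<theta>' else \<theta>))))) =
        (\<integral>\<^sup>+\<omega>2. \<integral>\<^sup>+x. f x \<partial>(measure_pmf (bernoulli_pmf (accept_prob \<theta> \<theta>' \<omega>1 \<omega>2)) \<bind>
          (\<lambda>b. return lam (if b then \<theta>' else \<theta>))) \<partial>P2 \<theta> \<theta>' \<omega>1)"
        by (intro nn_integral_bind[where B=lam] f measurable_prob_algebraD) measurable
      also have "\<dots> = (\<integral>\<^sup>+\<omega>2. accept_prob \<theta> \<theta>' \<omega>1 \<omega>2 * f \<theta>' + (1 - accept_prob \<theta> \<theta>' \<omega>1 \<omega>2) * f \<theta> \<partial>P2 \<theta> \<theta>' \<omega>1)"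
        using \<theta> \<theta>' \<omega>1 by (intro nn_integral_cong step) (simp_all add: space_kernels)
      also have "\<dots> = accept_mass \<theta> \<omega>1 \<theta>' * f \<theta>' +
          reject_mass \<theta> \<omega>1 \<theta>' * f \<theta>"
        unfolding accept_mass_def reject_mass_def
        by (subst nn_integral_add) (simp_all add: nn_integral_multc)
      finally show "(\<integral>\<^sup>+x. f x \<partial>(P2 \<theta> \<theta>' \<omega>1 \<bind> (\<lambda>\<omega>2.
          measure_pmf (bernoulli_pmf (accept_prob \<theta> \<theta>' \<omega>1 \<omega>2)) \<bind> (\<lambda>b. return lam (if b then \<theta>' else \<theta>))))) = \<dots>" .
    qed
    finally show "(\<integral>\<^sup>+x. f x \<partial>(Q \<omega>1 \<theta> \<bind> (\<lambda>\<theta>'. P2 \<theta> \<theta>' \<omega>1 \<bind> (\<lambda>\<omega>2.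
        measure_pmf (bernoulli_pmf (accept_prob \<theta> \<theta>' \<omega>1 \<omega>2)) \<bind> (\<lambda>b. return lam (if b then \<theta>' else \<theta>)))))) = \<dots>" .
  qed
  also have "\<dots> = (\<integral>\<^sup>+\<omega>1. (\<integral>\<^sup>+\<theta>'. accept_mass \<theta> \<omega>1 \<theta>' * f \<theta>' \<partial>Q \<omega>1 \<theta>) +
      (\<integral>\<^sup>+\<theta>'. reject_mass \<theta> \<omega>1 \<theta>' \<partial>Q \<omega>1 \<theta>) * f \<theta> \<partial>P1 \<theta>)"
  proof (intro nn_integral_cong)
    fix \<omega>1 assume "\<omega>1 \<in> space (P1 \<theta>)"
    then have \<omega>1 [measurable]: "\<omega>1 \<in> space lam1"
      using \<theta> by (simp add: space_kernels)
    note [measurable_cong] = sets_kernels(3)[OF \<omega>1 \<theta>]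
    show "(\<integral>\<^sup>+\<theta>'. accept_mass \<theta> \<omega>1 \<theta>' * f \<theta>' +
      reject_mass \<theta> \<omega>1 \<theta>' * f \<theta> \<partial>Q \<omega>1 \<theta>) =
      (\<integral>\<^sup>+\<theta>'. accept_mass \<theta> \<omega>1 \<theta>' * f \<theta>' \<partial>Q \<omega>1 \<theta>) +
      (\<integral>\<^sup>+\<theta>'. reject_mass \<theta> \<omega>1 \<theta>' \<partial>Q \<omega>1 \<theta>) * f \<theta>"
      by (subst nn_integral_add) (simp_all add: nn_integral_multc)
  qed
  also have "\<dots> = (\<integral>\<^sup>+\<omega>1. \<integral>\<^sup>+\<theta>'. accept_mass \<theta> \<omega>1 \<theta>' * f \<theta>' \<partial>Q \<omega>1 \<theta> \<partial>P1 \<theta>) + total_reject_mass \<theta> * f \<theta>"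
  proof -
    \<comment> \<open>Adding under the integral over \<open>P1 \<theta>\<close> needs the two inner
      integrals to be measurable in \<open>\<omega>1\<close>; their measure
      \<open>Q \<omega>1 \<theta>\<close> depends on \<open>\<omega>1\<close>, hence the kernel
      rule.\<close>
    have "(\<lambda>\<omega>1. \<integral>\<^sup>+\<theta>'. accept_mass \<theta> \<omega>1 \<theta>' * f \<theta>' \<partial>Q \<omega>1 \<theta>) \<in> borel_measurable lam1"
      by (rule measurable_nn_integral_kernel[where N=lam]) measurable
    moreover have "(\<lambda>\<omega>1. \<integral>\<^sup>+\<theta>'. reject_mass \<theta> \<omega>1 \<theta>' \<partial>Q \<omega>1 \<theta>) \<in> borel_measurable lam1"
      by (rule measurable_nn_integral_kernel[where N=lam]) measurable
    ultimately show ?thesis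
      unfolding total_reject_mass_def by (subst nn_integral_add) (simp_all add: nn_integral_multc)
  qed
  finally show ?thesis .
qed

section \<open>The density of accepted moves and its symmetry\<close>

text \<open>The numerator of the ratio contains the factor \<open>p \<theta>'\<close>. This is what
  permits the division by \<open>p \<theta>'\<close> in \<open>move_density\<close>.\<close>

lemma accept_mass_eq_0:
  assumes "\<theta> \<in> space lam" "\<theta>' \<in> space lam" "\<omega>1 \<in> space lam1" "p \<theta>' = 0"
  shows "accept_mass \<theta> \<omega>1 \<theta>' = 0"
  using assms by (simp add: accept_mass_def acceptance_ratio_def)

text \<open>The proposal law is first written with its density over \<open>lam\<close>, then
  rewritten over \<open>target\<close> by trading \<open>q\<close> for \<open>p * (q / p)\<close>.
  Only then are the integrals exchanged, so that Fubini meets two probability measures.\<close>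

lemma accepted_moves_eq:
  assumes \<theta>: "\<theta> \<in> space lam" and f [measurable]: "f \<in> borel_measurable lam"
  shows "(\<integral>\<^sup>+\<omega>1. \<integral>\<^sup>+\<theta>'. accept_mass \<theta> \<omega>1 \<theta>' * f \<theta>' \<partial>Q \<omega>1 \<theta> \<partial>P1 \<theta>) =
    (\<integral>\<^sup>+\<theta>'. move_density \<theta> \<theta>' * f \<theta>' \<partial>target)"
proof -
  note [measurable] = \<theta>
  note [measurable_cong] = sets_kernels(1)[OF \<theta>]
  interpret P1: prob_space "P1 \<theta>"
    using measurable_space[OF measurable_P1 \<theta>] by (simp add: space_prob_algebra)
  interpret P1_target: pair_prob_space "P1 \<theta>" target ..
  have "(\<integral>\<^sup>+\<omega>1. \<integral>\<^sup>+\<theta>'. accept_mass \<theta> \<omega>1 \<theta>' * f \<theta>' \<partial>Q \<omega>1 \<theta> \<partial>P1 \<theta>) =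
    (\<integral>\<^sup>+\<omega>1. \<integral>\<^sup>+\<theta>'. ennreal (q \<omega>1 \<theta> \<theta>' / p \<theta>') * accept_mass \<theta> \<omega>1 \<theta>' * f \<theta>' \<partial>target \<partial>P1 \<theta>)"
  proof (intro nn_integral_cong)
    fix \<omega>1 assume "\<omega>1 \<in> space (P1 \<theta>)"
    then have \<omega>1 [measurable]: "\<omega>1 \<in> space lam1"
      using \<theta> by (simp add: space_kernels)
    have "(\<integral>\<^sup>+\<theta>'. accept_mass \<theta> \<omega>1 \<theta>' * f \<theta>' \<partial>Q \<omega>1 \<theta>) =
        (\<integral>\<^sup>+\<theta>'. ennreal (q \<omega>1 \<theta> \<theta>') * (accept_mass \<theta> \<omega>1 \<theta>' * f \<theta>') \<partial>lam)"
      unfolding Q_eq[OF \<omega>1 \<theta>] by (rule nn_integral_density) measurable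
    also have "\<dots> = (\<integral>\<^sup>+\<theta>'. ennreal (p \<theta>') * (ennreal (q \<omega>1 \<theta> \<theta>' / p \<theta>') * accept_mass \<theta> \<omega>1 \<theta>' * f \<theta>') \<partial>lam)"
    proof (intro nn_integral_cong)
      fix \<theta>' assume \<theta>': "\<theta>' \<in> space lam"
      show "ennreal (q \<omega>1 \<theta> \<theta>') * (accept_mass \<theta> \<omega>1 \<theta>' * f \<theta>') =
        ennreal (p \<theta>') * (ennreal (q \<omega>1 \<theta> \<theta>' / p \<theta>') * accept_mass \<theta> \<omega>1 \<theta>' * f \<theta>')"
      \<comment> \<open>If \<open>p \<theta>'\<close> vanishes, the quotient says nothing about
        \<open>q\<close>, but the accepted mass is zero and so are both sides.\<close>
      proof (cases "p \<theta>' = 0")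
        case False
        then have "ennreal (q \<omega>1 \<theta> \<theta>') = ennreal (p \<theta>') * ennreal (q \<omega>1 \<theta> \<theta>' / p \<theta>')"
          using p_nonneg[OF \<theta>'] q_nonneg[OF \<omega>1 \<theta> \<theta>'] by (simp flip: ennreal_mult)
        then show ?thesis
          by (simp add: mult.assoc)
      qed (simp add: accept_mass_eq_0 \<theta> \<theta>' \<omega>1)
    qed
    also have "\<dots> = (\<integral>\<^sup>+\<theta>'. ennreal (q \<omega>1 \<theta> \<theta>' / p \<theta>') * accept_mass \<theta> \<omega>1 \<theta>' * f \<theta>' \<partial>target)"
      unfolding target_eq by (rule nn_integral_density[symmetric]) measurable
    finally show "(\<integral>\<^sup>+\<theta>'. accept_mass \<theta> \<omega>1 \<theta>' * f \<theta>' \<partial>Q \<omega>1 \<theta>) = \<dots>" .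
  qed
  also have "\<dots> = (\<integral>\<^sup>+\<theta>'. \<integral>\<^sup>+\<omega>1. ennreal (q \<omega>1 \<theta> \<theta>' / p \<theta>') * accept_mass \<theta> \<omega>1 \<theta>' * f \<theta>' \<partial>P1 \<theta> \<partial>target)"
    by (rule P1_target.Fubini'[symmetric]) measurable
  also have "\<dots> = (\<integral>\<^sup>+\<theta>'. move_density \<theta> \<theta>' * f \<theta>' \<partial>target)"
    unfolding move_density_def by (intro nn_integral_cong nn_integral_multc) simp
  finally show ?thesis .
qed

text \<open>
  Detailed balance: \<open>p \<theta> p \<theta>'\<close> times the integrand is the minimum of
  \<open>p \<theta> p1 \<theta> \<omega>1 q \<omega>1 \<theta> \<theta>' p2 \<theta> \<theta>' \<omega>1 \<omega>2\<close> and the same expression with \<open>\<theta>\<close> and \<open>\<theta>'\<close> exchanged.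
\<close>

lemma move_density_sym:
  assumes \<theta>: "\<theta> \<in> space lam" "0 < p \<theta>" and \<theta>': "\<theta>' \<in> space lam" "0 < p \<theta>'"
  shows "move_density \<theta> \<theta>' = move_density \<theta>' \<theta>"
proof -
  \<comment> \<open>The joint density of current state, auxiliary samples and proposal before the
    accept decision. Exchanging \<open>x\<close> and \<open>y\<close> keeps \<open>\<omega>1\<close>
    and \<open>\<omega>2\<close> in place.\<close>
  define D where "D x y \<omega>1 \<omega>2 = p x * joint_density p1 p2 x y \<omega>1 \<omega>2 * q \<omega>1 x y" for x y \<omega>1 \<omega>2
  \<comment> \<open>The right-hand side is visibly symmetric in \<open>x\<close> and
    \<open>y\<close>, with the integrals in the same order for both, so symmetry follows without
    exchanging them.\<close>
  have eq: "move_density x y =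
      (\<integral>\<^sup>+\<omega>1. \<integral>\<^sup>+\<omega>2. ennreal (min (D x y \<omega>1 \<omega>2) (D y x \<omega>1 \<omega>2) / (p x * p y)) \<partial>lam2 \<partial>lam1)"
    if x: "x \<in> space lam" "0 < p x" and y: "y \<in> space lam" "0 < p y" for x y
  proof -
    note [measurable] = x(1) y(1)
    have "move_density x y =
        (\<integral>\<^sup>+\<omega>1. ennreal (p1 x \<omega>1) * (ennreal (q \<omega>1 x y / p y) * accept_mass x \<omega>1 y) \<partial>lam1)"
      unfolding move_density_def P1_eq[OF x(1)] by (rule nn_integral_density) measurable
    also have "\<dots> = (\<integral>\<^sup>+\<omega>1. \<integral>\<^sup>+\<omega>2. ennreal (min (D x y \<omega>1 \<omega>2) (D y x \<omega>1 \<omega>2) / (p x * p y)) \<partial>lam2 \<partial>lam1)"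
    proof (intro nn_integral_cong)
      fix \<omega>1 assume \<omega>1 [measurable]: "\<omega>1 \<in> space lam1"
      have "accept_mass x \<omega>1 y = (\<integral>\<^sup>+\<omega>2. ennreal (p2 x y \<omega>1 \<omega>2) * ennreal (accept_prob x y \<omega>1 \<omega>2) \<partial>lam2)"
        unfolding accept_mass_def P2_eq[OF x(1) y(1) \<omega>1] by (rule nn_integral_density) measurable
      then have "ennreal (p1 x \<omega>1) * (ennreal (q \<omega>1 x y / p y) * accept_mass x \<omega>1 y) =
          (\<integral>\<^sup>+\<omega>2. ennreal (p1 x \<omega>1) * (ennreal (q \<omega>1 x y / p y) *
            (ennreal (p2 x y \<omega>1 \<omega>2) * ennreal (accept_prob x y \<omega>1 \<omega>2))) \<partial>lam2)"
        by (simp add: nn_integral_cmult)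
      also have "\<dots> = (\<integral>\<^sup>+\<omega>2. ennreal (min (D x y \<omega>1 \<omega>2) (D y x \<omega>1 \<omega>2) / (p x * p y)) \<partial>lam2)"
      proof (intro nn_integral_cong)
        fix \<omega>2 assume \<omega>2: "\<omega>2 \<in> space lam2"
        have nonneg: "0 \<le> D x y \<omega>1 \<omega>2" "0 \<le> D y x \<omega>1 \<omega>2"
          using x y \<omega>1 \<omega>2
          by (simp_all add: D_def joint_density_def p1_nonneg p2_nonneg q_nonneg)
        have "D x y \<omega>1 \<omega>2 * accept_prob x y \<omega>1 \<omega>2 = min (D x y \<omega>1 \<omega>2) (D y x \<omega>1 \<omega>2)"
        \<comment> \<open>If \<open>D x y\<close> is zero, both sides are zero because
          \<open>D y x\<close> is nonnegative, whatever value the ratio takes.\<close>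
        proof (cases "D x y \<omega>1 \<omega>2 = 0")
          case False
          have "acceptance_ratio p p1 p2 q x y \<omega>1 \<omega>2 = D y x \<omega>1 \<omega>2 / D x y \<omega>1 \<omega>2"
            by (simp add: acceptance_ratio_def D_def)
          then show ?thesis
            using False nonneg by (simp add: min_mult_distrib_left)
        qed (use nonneg in simp)
        \<comment> \<open>The factor \<open>p x\<close> of \<open>D\<close> is absent from the
          integrand, and \<open>p y\<close> divides \<open>q\<close>: hence the denominator
          \<open>p x * p y\<close>.\<close>
        then have "p1 x \<omega>1 * (q \<omega>1 x y / p y * (p2 x y \<omega>1 \<omega>2 * accept_prob x y \<omega>1 \<omega>2)) =
            min (D x y \<omega>1 \<omega>2) (D y x \<omega>1 \<omega>2) / (p x * p y)"
          using x(2) y(2) by (simp add: D_def joint_density_def field_simps)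
        then show "ennreal (p1 x \<omega>1) * (ennreal (q \<omega>1 x y / p y) *
            (ennreal (p2 x y \<omega>1 \<omega>2) * ennreal (accept_prob x y \<omega>1 \<omega>2))) =
            ennreal (min (D x y \<omega>1 \<omega>2) (D y x \<omega>1 \<omega>2) / (p x * p y))"
          using x y \<omega>1 \<omega>2 accept_prob_nonneg[OF x(1) y(1) \<omega>1 \<omega>2]
          by (simp add: p1_nonneg p2_nonneg q_nonneg flip: ennreal_mult)
      qed
      finally show "ennreal (p1 x \<omega>1) * (ennreal (q \<omega>1 x y / p y) * accept_mass x \<omega>1 y) = \<dots>" .
    qed
    finally show ?thesis .
  qed
  show ?thesis
    using assms by (simp add: eq min.commute mult.commute)
qed

section \<open>From symmetry of the density to reversibility\<close>

text \<open>The zero set of \<open>p\<close> has no mass under \<open>target\<close>. Symmetry of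
  \<open>move_density\<close>, available only where \<open>p\<close> is positive, therefore suffices
  under integrals.\<close>

lemma AE_target_pos: "AE \<theta> in target. \<theta> \<in> space lam \<and> 0 < p \<theta>"
  unfolding target_eq by (subst AE_density) (auto simp: ennreal_less_zero_iff intro!: AE_I2)

text \<open>Exchanging the arguments of \<open>f\<close> leaves the rejection term unchanged, as it
  only sees the diagonal. The term of accepted moves is invariant by Fubini for
  \<open>target\<close> with itself and symmetry of \<open>move_density\<close>.\<close>

lemma kernel_swap:
  assumes [measurable]: "(\<lambda>(\<theta>, \<theta>'). f \<theta> \<theta>') \<in> borel_measurable (lam \<Otimes>\<^sub>M lam)"
  shows "(\<integral>\<^sup>+\<theta>. \<integral>\<^sup>+\<theta>'. f \<theta> \<theta>' \<partial>kernel \<theta> \<partial>target) = (\<integral>\<^sup>+\<theta>. \<integral>\<^sup>+\<theta>'. f \<theta>' \<theta> \<partial>kernel \<theta> \<partial>target)"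
proof -
  interpret target_target: pair_prob_space target target ..
  have split: "(\<integral>\<^sup>+\<theta>. \<integral>\<^sup>+\<theta>'. g \<theta> \<theta>' \<partial>kernel \<theta> \<partial>target) =
      (\<integral>\<^sup>+\<theta>. \<integral>\<^sup>+\<theta>'. move_density \<theta> \<theta>' * g \<theta> \<theta>' \<partial>target \<partial>target) +
      (\<integral>\<^sup>+\<theta>. total_reject_mass \<theta> * g \<theta> \<theta> \<partial>target)"
    if [measurable]: "(\<lambda>(\<theta>, \<theta>'). g \<theta> \<theta>') \<in> borel_measurable (lam \<Otimes>\<^sub>M lam)" for g
  proof -
    have "(\<integral>\<^sup>+\<theta>. \<integral>\<^sup>+\<theta>'. g \<theta> \<theta>' \<partial>kernel \<theta> \<partial>target) =
        (\<integral>\<^sup>+\<theta>. (\<integral>\<^sup>+\<theta>'. move_density \<theta> \<theta>' * g \<theta> \<theta>' \<partial>target) + total_reject_mass \<theta> * g \<theta> \<theta> \<partial>target)"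
      by (intro nn_integral_cong) (simp add: nn_integral_kernel accepted_moves_eq)
    also have "\<dots> = (\<integral>\<^sup>+\<theta>. \<integral>\<^sup>+\<theta>'. move_density \<theta> \<theta>' * g \<theta> \<theta>' \<partial>target \<partial>target) +
        (\<integral>\<^sup>+\<theta>. total_reject_mass \<theta> * g \<theta> \<theta> \<partial>target)"
      by (rule nn_integral_add) measurable
    finally show ?thesis .
  qed
  have "(\<integral>\<^sup>+\<theta>. \<integral>\<^sup>+\<theta>'. move_density \<theta> \<theta>' * f \<theta> \<theta>' \<partial>target \<partial>target) =
      (\<integral>\<^sup>+\<theta>'. \<integral>\<^sup>+\<theta>. move_density \<theta> \<theta>' * f \<theta> \<theta>' \<partial>target \<partial>target)"
    by (rule target_target.Fubini'[symmetric]) measurable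
  also have "\<dots> = (\<integral>\<^sup>+\<theta>'. \<integral>\<^sup>+\<theta>. move_density \<theta>' \<theta> * f \<theta> \<theta>' \<partial>target \<partial>target)"
  \<comment> \<open>Positivity of \<open>p\<close> is needed at both states, hence one
    almost-everywhere argument for each integral.\<close>
  proof (rule nn_integral_cong_AE)
    show "AE \<theta>' in target. (\<integral>\<^sup>+\<theta>. move_density \<theta> \<theta>' * f \<theta> \<theta>' \<partial>target) =
        (\<integral>\<^sup>+\<theta>. move_density \<theta>' \<theta> * f \<theta> \<theta>' \<partial>target)"
      using AE_target_pos
    proof eventually_elim
      case (elim \<theta>')
      show ?case
        by (rule nn_integral_cong_AE, use AE_target_pos in eventually_elim)
          (use elim in \<open>simp add: move_density_sym\<close>)
    qed
  qed
  \<comment> \<open>\<open>split\<close> is applied to \<open>f\<close> and to \<open>f\<close> with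
    its arguments exchanged; the accepted terms then agree up to renaming of bound
    variables.\<close>
  finally show ?thesis
    by (simp add: split)
qed

text \<open>On a measurable set \<open>X\<close> of pairs, each joint law is an iterated integral of
  the indicator of \<open>X\<close>, and \<open>kernel_swap\<close> equates the two.\<close>

lemma reversible_kernel: "reversible target kernel"
proof -
  \<comment> \<open>\<open>kernel\<close> was shown measurable over \<open>lam\<close>, while
    \<open>reversible\<close> refers to \<open>target\<close>; the space of probability measures
    depends only on the sigma-algebra, which they share.\<close>
  have prob_algebra_eq: "prob_algebra target = prob_algebra lam"
    by (simp add: prob_algebra_def subprob_algebra_cong[OF sets_target])
  have kernel [measurable]: "kernel \<in> target \<rightarrow>\<^sub>M prob_algebra target"
    using measurable_kernel
    by (simp add: prob_algebra_eq cong: measurable_cong_sets)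
  have target [simp]: "target \<in> space (prob_algebra target)"
    by (simp add: space_prob_algebra prob_target)
  \<comment> \<open>The pairing \<open>g\<close> is left general so that one computation serves both
    orders of the pair.\<close>
  have emeasure_eq: "emeasure (target \<bind> (\<lambda>\<theta>. kernel \<theta> \<bind> (\<lambda>\<theta>'. return (target \<Otimes>\<^sub>M target) (g \<theta> \<theta>')))) X =
      (\<integral>\<^sup>+\<theta>. \<integral>\<^sup>+\<theta>'. indicator X (g \<theta> \<theta>') \<partial>kernel \<theta> \<partial>target)"
    if [measurable]: "(\<lambda>(\<theta>, \<theta>'). g \<theta> \<theta>') \<in> target \<Otimes>\<^sub>M target \<rightarrow>\<^sub>M target \<Otimes>\<^sub>M target"
      and X: "X \<in> sets (target \<Otimes>\<^sub>M target)" for g X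
  proof -
    have "emeasure (target \<bind> (\<lambda>\<theta>. kernel \<theta> \<bind> (\<lambda>\<theta>'. return (target \<Otimes>\<^sub>M target) (g \<theta> \<theta>')))) X =
        (\<integral>\<^sup>+\<theta>. emeasure (kernel \<theta> \<bind> (\<lambda>\<theta>'. return (target \<Otimes>\<^sub>M target) (g \<theta> \<theta>'))) X \<partial>target)"
      by (rule emeasure_bind_prob_algebra[OF target _ X]) measurable
    also have "\<dots> = (\<integral>\<^sup>+\<theta>. \<integral>\<^sup>+\<theta>'. emeasure (return (target \<Otimes>\<^sub>M target) (g \<theta> \<theta>')) X \<partial>kernel \<theta> \<partial>target)"
    proof (intro nn_integral_cong)
      fix \<theta> assume \<theta> [measurable]: "\<theta> \<in> space target"
      show "emeasure (kernel \<theta> \<bind> (\<lambda>\<theta>'. return (target \<Otimes>\<^sub>M target) (g \<theta> \<theta>'))) X =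
          (\<integral>\<^sup>+\<theta>'. emeasure (return (target \<Otimes>\<^sub>M target) (g \<theta> \<theta>')) X \<partial>kernel \<theta>)"
        by (rule emeasure_bind_prob_algebra[OF measurable_space[OF kernel \<theta>] _ X]) measurable
    qed
    finally show ?thesis
      using X by simp
  qed
  have sets_eq: "sets (target \<bind> (\<lambda>\<theta>. kernel \<theta> \<bind> (\<lambda>\<theta>'. return (target \<Otimes>\<^sub>M target) (g \<theta> \<theta>')))) =
      sets (target \<Otimes>\<^sub>M target)"
    if [measurable]: "(\<lambda>(\<theta>, \<theta>'). g \<theta> \<theta>') \<in> target \<Otimes>\<^sub>M target \<rightarrow>\<^sub>M target \<Otimes>\<^sub>M target" for g
    by (rule sets_bind'[OF target]) measurable
  have "(target \<bind> (\<lambda>\<theta>. kernel \<theta> \<bind> (\<lambda>\<theta>'. return (target \<Otimes>\<^sub>M target) (\<theta>, \<theta>')))) =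
      (target \<bind> (\<lambda>\<theta>'. kernel \<theta>' \<bind> (\<lambda>\<theta>. return (target \<Otimes>\<^sub>M target) (\<theta>, \<theta>'))))"
  proof (rule measure_eqI)
    show "sets (target \<bind> (\<lambda>\<theta>. kernel \<theta> \<bind> (\<lambda>\<theta>'. return (target \<Otimes>\<^sub>M target) (\<theta>, \<theta>')))) =
        sets (target \<bind> (\<lambda>\<theta>'. kernel \<theta>' \<bind> (\<lambda>\<theta>. return (target \<Otimes>\<^sub>M target) (\<theta>, \<theta>'))))"
      by (simp add: sets_eq)
  next
    fix X assume "X \<in> sets (target \<bind> (\<lambda>\<theta>. kernel \<theta> \<bind> (\<lambda>\<theta>'. return (target \<Otimes>\<^sub>M target) (\<theta>, \<theta>'))))"
    then have X [measurable]: "X \<in> sets (target \<Otimes>\<^sub>M target)"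
      by (simp add: sets_eq)
    have "sets (target \<Otimes>\<^sub>M target) = sets (lam \<Otimes>\<^sub>M lam)"
      by (intro sets_pair_measure_cong) simp_all
    with X have [measurable]: "X \<in> sets (lam \<Otimes>\<^sub>M lam)"
      by simp
    have "(\<integral>\<^sup>+\<theta>. \<integral>\<^sup>+\<theta>'. indicator X (\<theta>, \<theta>') \<partial>kernel \<theta> \<partial>target) =
        (\<integral>\<^sup>+\<theta>. \<integral>\<^sup>+\<theta>'. indicator X (\<theta>', \<theta>) \<partial>kernel \<theta> \<partial>target :: ennreal)"
      by (rule kernel_swap) simp
    then show "emeasure (target \<bind> (\<lambda>\<theta>. kernel \<theta> \<bind> (\<lambda>\<theta>'. return (target \<Otimes>\<^sub>M target) (\<theta>, \<theta>')))) X =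
        emeasure (target \<bind> (\<lambda>\<theta>'. kernel \<theta>' \<bind> (\<lambda>\<theta>. return (target \<Otimes>\<^sub>M target) (\<theta>, \<theta>')))) X"
      by (simp add: emeasure_eq)
  qed
  with kernel show ?thesis
    by (simp add: reversible_def markov_kernel_def)
qed

end

theorem proposition2:
  fixes lam :: "'a measure" and lam1 :: "'b measure" and lam2 :: "'c measure"
    and target :: "'a measure" and p :: "'a \<Rightarrow> real"
    and P1 :: "'a \<Rightarrow> 'b measure" and p1 :: "'a \<Rightarrow> 'b \<Rightarrow> real"
    and P2 :: "'a \<Rightarrow> 'a \<Rightarrow> 'b \<Rightarrow> 'c measure" and p2 :: "'a \<Rightarrow> 'a \<Rightarrow> 'b \<Rightarrow> 'c \<Rightarrow> real"
    and Q :: "'b \<Rightarrow> 'a \<Rightarrow> 'a measure" and q :: "'b \<Rightarrow> 'a \<Rightarrow> 'a \<Rightarrow> real"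
  assumes "prob_space target"
    and "p \<in> borel_measurable lam"
    and "\<And>\<theta>. \<theta> \<in> space lam \<Longrightarrow> 0 \<le> p \<theta>"
    and "target = density lam (\<lambda>\<theta>. ennreal (p \<theta>))"
    and "P1 \<in> lam \<rightarrow>\<^sub>M prob_algebra lam1"
    and "(\<lambda>(\<theta>, \<omega>1). p1 \<theta> \<omega>1) \<in> borel_measurable (lam \<Otimes>\<^sub>M lam1)"
    and "\<And>\<theta> \<omega>1. \<theta> \<in> space lam \<Longrightarrow> \<omega>1 \<in> space lam1 \<Longrightarrow> 0 \<le> p1 \<theta> \<omega>1"
    and "\<And>\<theta>. \<theta> \<in> space lam \<Longrightarrow> P1 \<theta> = density lam1 (\<lambda>\<omega>1. ennreal (p1 \<theta> \<omega>1))"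
    and "(\<lambda>(\<theta>, \<theta>', \<omega>1). P2 \<theta> \<theta>' \<omega>1) \<in> lam \<Otimes>\<^sub>M lam \<Otimes>\<^sub>M lam1 \<rightarrow>\<^sub>M prob_algebra lam2"
    and "(\<lambda>(\<theta>, \<theta>', \<omega>1, \<omega>2). p2 \<theta> \<theta>' \<omega>1 \<omega>2)
           \<in> borel_measurable (lam \<Otimes>\<^sub>M lam \<Otimes>\<^sub>M lam1 \<Otimes>\<^sub>M lam2)"
    and "\<And>\<theta> \<theta>' \<omega>1 \<omega>2. \<theta> \<in> space lam \<Longrightarrow> \<theta>' \<in> space lam \<Longrightarrow> \<omega>1 \<in> space lam1 \<Longrightarrow>
           \<omega>2 \<in> space lam2 \<Longrightarrow> 0 \<le> p2 \<theta> \<theta>' \<omega>1 \<omega>2"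
    and "\<And>\<theta> \<theta>' \<omega>1. \<theta> \<in> space lam \<Longrightarrow> \<theta>' \<in> space lam \<Longrightarrow> \<omega>1 \<in> space lam1 \<Longrightarrow>
           P2 \<theta> \<theta>' \<omega>1 = density lam2 (\<lambda>\<omega>2. ennreal (p2 \<theta> \<theta>' \<omega>1 \<omega>2))"
    and "(\<lambda>(\<omega>1, \<theta>). Q \<omega>1 \<theta>) \<in> lam1 \<Otimes>\<^sub>M lam \<rightarrow>\<^sub>M prob_algebra lam"
    and "(\<lambda>(\<omega>1, \<theta>, \<theta>'). q \<omega>1 \<theta> \<theta>') \<in> borel_measurable (lam1 \<Otimes>\<^sub>M lam \<Otimes>\<^sub>M lam)"
    and "\<And>\<omega>1 \<theta> \<theta>'. \<omega>1 \<in> space lam1 \<Longrightarrow> \<theta> \<in> space lam \<Longrightarrow> \<theta>' \<in> space lam \<Longrightarrow> 0 \<le> q \<omega>1 \<theta> \<theta>'"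
    and "\<And>\<omega>1 \<theta>. \<omega>1 \<in> space lam1 \<Longrightarrow> \<theta> \<in> space lam \<Longrightarrow>
           Q \<omega>1 \<theta> = density lam (\<lambda>\<theta>'. ennreal (q \<omega>1 \<theta> \<theta>'))"
  shows "reversible target (aux_kernel lam p P1 p1 P2 p2 Q q)"
proof -
  interpret auxiliary_mcmc lam lam1 lam2 target p P1 p1 P2 p2 Q q
    by (rule auxiliary_mcmc.intro) (fact assms)+
  show ?thesis
    by (rule reversible_kernel)
qed

end
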